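(* Let $N\ge 1$, let $G_j\subset\mathbb R^{m_j}$ be bounded domains and $p_j\in G_j$ for $j=1,\ldots,N$. Put $G=G_1\times\cdots\times G_N\subset\mathbb R^{m_1+\cdots+m_N}$ and $p=(p_1,\ldots,p_N)$, where the product is equipped with its Euclidean norm. Then $$M_G(p)^2=\sum_{j=1}^N M_{G_j}(p_j)^2 .$$
   Context: $\mathbb D=\{z\in\mathbb C:|z|<1\}$. A map $\mathbb D\to\mathbb R^m$ is harmonic if each of its real components is harmonic. For a harmonic map $f:\mathbb D\to\mathbb R^m$, $df_0:\mathbb R^2\to\mathbb R^m$ is its real differential at the origin and $\|df_0\|$ is the operator norm with respect to the Euclidean norms. For a bounded domain $G\subset\mathbb R^m$ and $p\in G$, $$M_G(p)=\sup\{\|df_0\|: f:\mathbb D\to G\ \text{harmonic},\ f(0)=p\}.$$ *)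

theory Defs
  imports "HOL-Analysis.Analysis"
begin

text \<open>
  The dimension has to be an ordinary natural number here, since a product of a varying number of
  spaces of varying dimensions is formed. So the real \<open>m\<close>-dimensional space is the library's
  \<open>Euclidean_space m\<close>: its points are the sequences \<open>x :: nat \<Rightarrow> real\<close> with \<open>x i = 0\<close> for
  \<open>i \<ge> m\<close>, and the Euclidean norm of such an \<open>x\<close> is \<open>L2_set x {..<m}\<close>.
\<close>

definition bounded_domain :: "nat \<Rightarrow> (nat \<Rightarrow> real) set \<Rightarrow> bool" where
  "bounded_domain m G \<longleftrightarrow>
     G \<noteq> {} \<and> openin (Euclidean_space m) G \<and> connectedin (Euclidean_space m) G \<and>
     (\<exists>B. \<forall>x\<in>G. L2_set x {..<m} \<le> B)"

text \<open>The plane is identified with \<^typ>\<open>complex\<close>; the coordinate directions are \<open>1\<close> and \<open>\<i>\<close>.\<close>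

definition dir_deriv :: "complex \<Rightarrow> (complex \<Rightarrow> real) \<Rightarrow> complex \<Rightarrow> real" where
  "dir_deriv v u z = frechet_derivative u (at z) v"

text \<open>The next two notions are meant for open \<open>S\<close>.\<close>

definition C1_on :: "complex set \<Rightarrow> (complex \<Rightarrow> real) \<Rightarrow> bool" where
  "C1_on S u \<longleftrightarrow> (\<forall>z\<in>S. u differentiable (at z)) \<and>
     continuous_on S (dir_deriv 1 u) \<and> continuous_on S (dir_deriv \<i> u)"

definition harmonic_on :: "complex set \<Rightarrow> (complex \<Rightarrow> real) \<Rightarrow> bool" where
  "harmonic_on S u \<longleftrightarrow>
     C1_on S u \<and> C1_on S (dir_deriv 1 u) \<and> C1_on S (dir_deriv \<i> u) \<and>
     (\<forall>z\<in>S. dir_deriv 1 (dir_deriv 1 u) z + dir_deriv \<i> (dir_deriv \<i> u) z = 0)"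

definition harmonic_map_on :: "complex set \<Rightarrow> nat \<Rightarrow> (complex \<Rightarrow> nat \<Rightarrow> real) \<Rightarrow> bool" where
  "harmonic_map_on S m f \<longleftrightarrow> (\<forall>i<m. harmonic_on S (\<lambda>z. f z i))"

definition differential :: "(complex \<Rightarrow> nat \<Rightarrow> real) \<Rightarrow> complex \<Rightarrow> complex \<Rightarrow> nat \<Rightarrow> real" where
  "differential f z v = (\<lambda>i. frechet_derivative (\<lambda>w. f w i) (at z) v)"

text \<open>Analogue of \<^const>\<open>onorm\<close> with the Euclidean norm on the codomain.\<close>

definition op_norm :: "nat \<Rightarrow> (complex \<Rightarrow> nat \<Rightarrow> real) \<Rightarrow> real" where
  "op_norm m A = (SUP v. L2_set (A v) {..<m} / norm v)"

definition M_dom :: "nat \<Rightarrow> (nat \<Rightarrow> real) set \<Rightarrow> (nat \<Rightarrow> real) \<Rightarrow> real" where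
  "M_dom m G p =
     Sup {op_norm m (differential f 0) | f.
            harmonic_map_on (ball 0 1) m f \<and> f ` ball 0 1 \<subseteq> G \<and> f 0 = p}"

text \<open>
  \<open>concat_vec N m x\<close> is the point \<open>(x 1, \<dots>, x N)\<close> of the space of dimension
  \<open>m 1 + \<dots> + m N\<close>, where \<open>x j\<close> has dimension \<open>m j\<close>: the coordinates of \<open>x j\<close> occupy the
  positions from \<open>offset m j\<close> to \<open>offset m j + m j - 1\<close>. For each position at most one summand
  in the definition is nonzero.
\<close>

definition offset :: "(nat \<Rightarrow> nat) \<Rightarrow> nat \<Rightarrow> nat" where
  "offset m j = (\<Sum>k\<in>{1..<j}. m k)"

definition concat_vec :: "nat \<Rightarrow> (nat \<Rightarrow> nat) \<Rightarrow> (nat \<Rightarrow> nat \<Rightarrow> real) \<Rightarrow> nat \<Rightarrow> real" where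
  "concat_vec N m x =
     (\<lambda>i. \<Sum>j=1..N. if offset m j \<le> i \<and> i < offset m j + m j then x j (i - offset m j) else 0)"

definition prod_dom ::
  "nat \<Rightarrow> (nat \<Rightarrow> nat) \<Rightarrow> (nat \<Rightarrow> (nat \<Rightarrow> real) set) \<Rightarrow> (nat \<Rightarrow> real) set" where
  "prod_dom N m G = {concat_vec N m x | x. \<forall>j\<in>{1..N}. x j \<in> G j}"

lemma offset_mono: "j < k \<Longrightarrow> 1 \<le> j \<Longrightarrow> offset m j + m j \<le> offset m k"
proof -
  assume "j < k" "1 \<le> j"
  then have "offset m j + m j = (\<Sum>l\<in>{1..<Suc j}. m l)"
    by (simp add: offset_def)
  also have "\<dots> \<le> offset m k"
    unfolding offset_def using \<open>j < k\<close> by (intro sum_mono2) auto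
  finally show ?thesis .
qed

lemma concat_vec_block:
  assumes "j \<in> {1..N}" "i < m j"
  shows "concat_vec N m x (offset m j + i) = x j i"
proof -
  have "concat_vec N m x (offset m j + i) = (\<Sum>k=1..N. if k = j then x j i else 0)"
    unfolding concat_vec_def
  proof (rule sum.cong)
    fix k assume "k \<in> {1..N}"
    then show "(if offset m k \<le> offset m j + i \<and> offset m j + i < offset m k + m k
          then x k (offset m j + i - offset m k) else 0) = (if k = j then x j i else 0)"
      using assms offset_mono[of j k m] offset_mono[of k j m]
      by (cases k j rule: linorder_cases) auto
  qed simp
  then show ?thesis using assms by simp
qed

lemma concat_vec_outside:
  assumes "(\<Sum>j=1..N. m j) \<le> i"
  shows "concat_vec N m x i = 0"
proof -
  have "offset m k + m k \<le> i" if "k \<in> {1..N}" for k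
    using offset_mono[of k "Suc N" m] that assms
    by (simp add: offset_def atLeastLessThanSuc_atLeastAtMost)
  then show ?thesis
    unfolding concat_vec_def by (intro sum.neutral) (metis not_less)
qed

end

theory Submission
  imports Defs "HOL-Complex_Analysis.Cauchy_Integral_Formula"
begin

text \<open>
  A harmonic map into the product is a tuple of harmonic maps \<open>f j\<close> into the factors, and
  \<open>(norm (df v))\<^sup>2\<close> is the sum of the \<open>(norm (df j v))\<^sup>2\<close>; this gives one inequality. For the other
  one, nearly extremal maps for the factors may stretch different directions most, but precomposing
  each of them with a rotation of the disk turns these directions into \<open>1\<close>, so that one tuple is
  nearly extremal in every factor. The suprema are finite by a gradient bound for bounded harmonic
  functions on the disk.
\<close>

section \<open>Symmetry of second derivatives\<close>

text \<open>The mean value theorem in the direction \<open>v\<close> turns the second difference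
  into \<open>t\<close> times a difference of values of \<open>u' x v\<close>. Differentiability of
  \<open>u' x v\<close> at \<open>z\<close> evaluates this difference as \<open>t * g' w\<close> up
  to o(t).\<close>

lemma second_difference_tendsto:
  fixes u :: "'a::real_normed_vector \<Rightarrow> real"
  assumes S: "open S" "z \<in> S"
    and u': "\<And>x. x \<in> S \<Longrightarrow> (u has_derivative u' x) (at x)"
    and g': "((\<lambda>x. u' x v) has_derivative g') (at z)"
  shows "((\<lambda>t. (u (z + t *\<^sub>R v + t *\<^sub>R w) - u (z + t *\<^sub>R v) - u (z + t *\<^sub>R w) + u z) / t\<^sup>2)
           \<longlongrightarrow> g' w) (at_right 0)"
proof (rule tendstoI)
  fix e :: real assume "e > 0"
  \<comment> \<open>The two linearization errors below add up to at most
    \<open>e / K * t * (2 * norm v + norm w)\<close>. The extra 1 makes this strictly less than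
    \<open>e * t\<close> and keeps \<open>K\<close> positive for zero vectors.\<close>
  define K where "K = 2 * norm v + norm w + 1"
  have "K > 0" by (simp add: K_def add_nonneg_pos)
  interpret g': bounded_linear g' using g' by (rule has_derivative_bounded_linear)
  have "e / K > 0" using \<open>e > 0\<close> \<open>K > 0\<close> by simp
  then obtain d1 where "d1 > 0" and d1: "\<And>y. norm (y - z) < d1 \<Longrightarrow>
      norm (u' y v - u' z v - g' (y - z)) \<le> e / K * norm (y - z)"
    using g' unfolding has_derivative_at_alt by meson
  obtain d2 where "d2 > 0" and d2: "ball z d2 \<subseteq> S"
    using S by (meson open_contains_ball)
  define d where "d = min d1 d2 / K"
  have "d > 0" using \<open>d1 > 0\<close> \<open>d2 > 0\<close> \<open>K > 0\<close> by (simp add: d_def)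
  have main: "dist ((u (z + t *\<^sub>R v + t *\<^sub>R w) - u (z + t *\<^sub>R v) - u (z + t *\<^sub>R w) + u z) / t\<^sup>2) (g' w) < e"
    if t: "0 < t" "t < d" for t
  proof -
    have small: "norm (s *\<^sub>R v + r *\<^sub>R w) < min d1 d2"
      if "0 \<le> s" "s \<le> t" "0 \<le> r" "r \<le> t" for s r
    proof -
      have "norm (s *\<^sub>R v + r *\<^sub>R w) \<le> s * norm v + r * norm w"
        using that norm_triangle_ineq[of "s *\<^sub>R v" "r *\<^sub>R w"] by simp
      also have "\<dots> \<le> t * norm v + t * norm w"
        using that by (intro add_mono mult_right_mono) auto
      also have "\<dots> \<le> t * K"
        using t by (simp add: K_def algebra_simps)
      also have "\<dots> < d * K" using t \<open>K > 0\<close> by simp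
      finally show ?thesis using \<open>K > 0\<close> by (simp add: d_def)
    qed
    have inS: "z + s *\<^sub>R v + r *\<^sub>R w \<in> S" if "0 \<le> s" "s \<le> t" "0 \<le> r" "r \<le> t" for s r
      using small[OF that] d2 by (auto simp: dist_norm subset_iff norm_minus_commute add.assoc)
    \<comment> \<open>The increment in direction \<open>w\<close> as a function of the shift in
      direction \<open>v\<close>; its own increment over \<open>{0..t}\<close> is the second
      difference.\<close>
    define \<phi> where "\<phi> s = u (z + s *\<^sub>R v + t *\<^sub>R w) - u (z + s *\<^sub>R v)" for s
    have der: "(\<phi> has_derivative (\<lambda>h. h * (u' (z + s *\<^sub>R v + t *\<^sub>R w) v - u' (z + s *\<^sub>R v) v)))
        (at s within {0..t})"
      if s: "0 \<le> s" "s \<le> t" for s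
    proof -
      have A: "(u has_derivative u' (z + s *\<^sub>R v + t *\<^sub>R w)) (at (z + s *\<^sub>R v + t *\<^sub>R w))"
        using inS[of s t] s t by (intro u') auto
      have B: "(u has_derivative u' (z + s *\<^sub>R v)) (at (z + s *\<^sub>R v))"
        using inS[of s 0] s t by (intro u') auto
      note bl = A[THEN has_derivative_bounded_linear, THEN bounded_linear.linear]
        B[THEN has_derivative_bounded_linear, THEN bounded_linear.linear]
      have "(\<phi> has_derivative (\<lambda>h. u' (z + s *\<^sub>R v + t *\<^sub>R w) (h *\<^sub>R v) - u' (z + s *\<^sub>R v) (h *\<^sub>R v)))
        (at s within {0..t})"
        unfolding \<phi>_def
        by (intro has_derivative_diff has_derivative_compose[where g = u and f = "\<lambda>s. z + s *\<^sub>R v + t *\<^sub>R w", OF _ A]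
              has_derivative_compose[where g = u and f = "\<lambda>s. z + s *\<^sub>R v", OF _ B])
          (auto intro!: derivative_eq_intros)
      then show ?thesis
        using bl by (simp add: linear_cmul algebra_simps)
    qed
    obtain s where s: "s \<in> {0<..<t}"
      and D: "\<phi> t - \<phi> 0 = (t - 0) * (u' (z + s *\<^sub>R v + t *\<^sub>R w) v - u' (z + s *\<^sub>R v) v)"
      using mvt_simple[OF t(1), of \<phi>, OF der] by blast
    \<comment> \<open>\<open>a\<close> and \<open>b\<close> are the remainders of the linearization
      of \<open>u' x v\<close> at the two points from the mean value theorem. Subtracting them
      cancels \<open>g' (s *\<^sub>R v)\<close> and leaves \<open>t * g' w\<close>.\<close>
    define a where "a = u' (z + s *\<^sub>R v + t *\<^sub>R w) v - u' z v - g' (s *\<^sub>R v + t *\<^sub>R w)"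
    define b where "b = u' (z + s *\<^sub>R v) v - u' z v - g' (s *\<^sub>R v)"
    have "\<bar>a\<bar> \<le> e / K * norm (s *\<^sub>R v + t *\<^sub>R w)"
      using d1[of "z + s *\<^sub>R v + t *\<^sub>R w"] small[of s t] s by (simp add: a_def add.assoc)
    moreover have "norm (s *\<^sub>R v + t *\<^sub>R w) \<le> t * norm v + t * norm w"
    proof -
      have "norm (s *\<^sub>R v + t *\<^sub>R w) \<le> s * norm v + t * norm w"
        using norm_triangle_ineq[of "s *\<^sub>R v" "t *\<^sub>R w"] s by simp
      also have "\<dots> \<le> t * norm v + t * norm w"
        using s by (intro add_mono mult_right_mono) auto
      finally show ?thesis .
    qed
    ultimately have "\<bar>a\<bar> \<le> e / K * (t * norm v + t * norm w)"
      using \<open>e / K > 0\<close> by (meson mult_left_mono less_imp_le order_trans)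
    moreover have "\<bar>b\<bar> \<le> e / K * norm (s *\<^sub>R v)"
      using d1[of "z + s *\<^sub>R v"] small[of s 0] s by (simp add: b_def)
    moreover have "norm (s *\<^sub>R v) \<le> t * norm v"
      using s by (auto intro: mult_right_mono)
    ultimately have "\<bar>a - b\<bar> \<le> e / K * (t * norm v + t * norm w) + e / K * (t * norm v)"
      using \<open>e / K > 0\<close> by (smt (verit) mult_left_mono)
    also have "\<dots> = e / K * ((t * norm v + t * norm w) + t * norm v)"
      by (simp only: distrib_left)
    also have "(t * norm v + t * norm w) + t * norm v = t * (K - 1)"
      by (simp add: K_def algebra_simps)
    also have "e / K * (t * (K - 1)) < e / K * (t * K)"
      using \<open>e / K > 0\<close> t by (intro mult_strict_left_mono) auto
    finally have ab: "\<bar>a - b\<bar> < e * t" using \<open>K > 0\<close> by simp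
    have "u' (z + s *\<^sub>R v + t *\<^sub>R w) v - u' (z + s *\<^sub>R v) v = t * g' w + (a - b)"
      by (simp add: a_def b_def g'.add g'.scaleR)
    with D have "\<phi> t - \<phi> 0 = t * (t * g' w + (a - b))"
      by simp
    then have "(\<phi> t - \<phi> 0) / t\<^sup>2 - g' w = (a - b) / t"
      using t by (simp add: power2_eq_square add_divide_distrib)
    moreover have "\<bar>(a - b) / t\<bar> < e"
      using ab t by (simp add: field_simps)
    moreover have "u (z + t *\<^sub>R v + t *\<^sub>R w) - u (z + t *\<^sub>R v) - u (z + t *\<^sub>R w) + u z = \<phi> t - \<phi> 0"
      by (simp add: \<phi>_def)
    ultimately show ?thesis
      by (simp add: dist_real_def)
  qed
  show "\<forall>\<^sub>F t in at_right 0. dist ((u (z + t *\<^sub>R v + t *\<^sub>R w) - u (z + t *\<^sub>R v) - u (z + t *\<^sub>R w) + u z) / t\<^sup>2)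
          (g' w) < e"
    using main \<open>d > 0\<close> by (intro eventually_at_rightI[of 0 d]) auto
qed

text \<open>The second difference is unchanged when \<open>v\<close> and \<open>w\<close> are
  swapped, so both mixed derivatives are limits of the same quotient.\<close>

lemma second_derivative_symmetric:
  fixes u :: "'a::real_normed_vector \<Rightarrow> real"
  assumes "open S" "z \<in> S"
    and "\<And>x. x \<in> S \<Longrightarrow> (u has_derivative u' x) (at x)"
    and g: "((\<lambda>x. u' x v) has_derivative g) (at z)"
    and h: "((\<lambda>x. u' x w) has_derivative h) (at z)"
  shows "g w = h v"
proof (rule tendsto_unique)
  show "((\<lambda>t. (u (z + t *\<^sub>R v + t *\<^sub>R w) - u (z + t *\<^sub>R v) - u (z + t *\<^sub>R w) + u z) / t\<^sup>2)
           \<longlongrightarrow> g w) (at_right 0)"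
    using assms by (intro second_difference_tendsto)
  show "((\<lambda>t. (u (z + t *\<^sub>R v + t *\<^sub>R w) - u (z + t *\<^sub>R v) - u (z + t *\<^sub>R w) + u z) / t\<^sup>2)
           \<longlongrightarrow> h v) (at_right 0)"
    using second_difference_tendsto[OF assms(1-3) h, of v] by (simp add: algebra_simps)
qed simp

section \<open>Harmonic functions\<close>

lemma has_derivative_dir_deriv:
  "u differentiable (at z) \<Longrightarrow> (u has_derivative (\<lambda>v. dir_deriv v u z)) (at z)"
  by (simp add: dir_deriv_def frechet_derivative_works[symmetric])

lemma dir_deriv_eqI: "(u has_derivative u') (at z) \<Longrightarrow> dir_deriv v u z = u' v"
  by (metis dir_deriv_def frechet_derivative_at)

lemma dir_deriv_eq_Re_Im:
  assumes "u differentiable (at z)"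
  shows "dir_deriv v u z = Re v * dir_deriv 1 u z + Im v * dir_deriv \<i> u z"
proof -
  interpret bounded_linear "\<lambda>v. dir_deriv v u z"
    using has_derivative_dir_deriv[OF assms] by (rule has_derivative_bounded_linear)
  have "v = Re v *\<^sub>R 1 + Im v *\<^sub>R \<i>"
    by (simp add: complex_eq_iff)
  then have "dir_deriv v u z = dir_deriv (Re v *\<^sub>R 1 + Im v *\<^sub>R \<i>) u z"
    by (rule arg_cong)
  also have "\<dots> = Re v * dir_deriv 1 u z + Im v * dir_deriv \<i> u z"
    by (simp only: add scaleR real_scaleR_def)
  finally show ?thesis .
qed

lemma C1_on_differentiable: "C1_on S u \<Longrightarrow> z \<in> S \<Longrightarrow> u differentiable (at z)"
  by (simp add: C1_on_def)

text \<open>Derivatives are local on an open set. This allows \<open>dir_deriv v\<close> of a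
  composite, known only on that set, to be replaced by an explicit formula before differentiating
  again.\<close>

lemma C1_on_cong:
  assumes "open S" "\<forall>z\<in>S. u z = w z" "C1_on S u"
  shows "C1_on S w" and "\<And>z v. z \<in> S \<Longrightarrow> dir_deriv v w z = dir_deriv v u z"
proof -
  have der: "(w has_derivative (\<lambda>v. dir_deriv v u z)) (at z)" if "z \<in> S" for z
    using has_derivative_dir_deriv[OF C1_on_differentiable[OF assms(3) that]] assms(1) that
    by (rule has_derivative_transform_within_open) (use assms(2) in blast)
  then show eq: "dir_deriv v w z = dir_deriv v u z" if "z \<in> S" for z v
    using that by (intro dir_deriv_eqI)
  show "C1_on S w"
    using assms(3) eq der unfolding C1_on_def
    by (auto simp: differentiable_def cong: continuous_on_cong)
qed

lemma C1_on_linear_combination: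
  assumes u: "C1_on S u" and w: "C1_on S w"
  shows "C1_on S (\<lambda>z. a * u z + b * w z)"
    and "\<And>z v. z \<in> S \<Longrightarrow>
      dir_deriv v (\<lambda>z. a * u z + b * w z) z = a * dir_deriv v u z + b * dir_deriv v w z"
proof -
  have der: "((\<lambda>z. a * u z + b * w z) has_derivative
      (\<lambda>v. a * dir_deriv v u z + b * dir_deriv v w z)) (at z)" if "z \<in> S" for z
    using has_derivative_dir_deriv[OF C1_on_differentiable[OF u that]]
      has_derivative_dir_deriv[OF C1_on_differentiable[OF w that]]
    by (intro has_derivative_add has_derivative_mult_right)
  then show eq: "dir_deriv v (\<lambda>z. a * u z + b * w z) z = a * dir_deriv v u z + b * dir_deriv v w z"
    if "z \<in> S" for z v
    using that by (intro dir_deriv_eqI)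
  show "C1_on S (\<lambda>z. a * u z + b * w z)"
    using u w der eq unfolding C1_on_def
    by (auto simp: differentiable_def intro!: continuous_intros cong: continuous_on_cong)
qed

text \<open>Chain rule. The direction \<open>c * v\<close> is expanded over \<open>1\<close> and
  \<open>\<i>\<close>, the two directions in which \<open>C1_on\<close> provides continuity.\<close>

lemma C1_on_compose_mult:
  assumes u: "C1_on S u" and c: "(*) c ` T \<subseteq> S"
  shows "C1_on T (\<lambda>z. u (c * z))"
    and "\<And>z v. z \<in> T \<Longrightarrow> dir_deriv v (\<lambda>z. u (c * z)) z =
      Re (c * v) * dir_deriv 1 u (c * z) + Im (c * v) * dir_deriv \<i> u (c * z)"
proof -
  have der: "((\<lambda>z. u (c * z)) has_derivative (\<lambda>v. dir_deriv (c * v) u (c * z))) (at z)"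
    if "z \<in> T" for z
  proof -
    have "u differentiable (at (c * z))"
      using c that by (intro C1_on_differentiable[OF u]) auto
    then have "(u has_derivative (\<lambda>v. dir_deriv v u (c * z))) (at (c * z))"
      by (rule has_derivative_dir_deriv)
    then show ?thesis
      by (rule has_derivative_compose[rotated]) (auto intro!: derivative_eq_intros)
  qed
  then show eq: "dir_deriv v (\<lambda>z. u (c * z)) z =
      Re (c * v) * dir_deriv 1 u (c * z) + Im (c * v) * dir_deriv \<i> u (c * z)" if "z \<in> T" for z v
  proof -
    have "u differentiable (at (c * z))"
      using c that by (intro C1_on_differentiable[OF u]) auto
    then show ?thesis
      using dir_deriv_eqI[OF der[OF that]] dir_deriv_eq_Re_Im[of u "c * z" "c * v"] by simp
  qed
  have "continuous_on T (\<lambda>z. dir_deriv v u (c * z))" if "continuous_on S (dir_deriv v u)" for v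
    by (rule continuous_on_compose2[OF that]) (use c in \<open>auto intro!: continuous_intros\<close>)
  then show "C1_on T (\<lambda>z. u (c * z))"
    using u der eq unfolding C1_on_def
    by (auto simp: differentiable_def intro!: continuous_intros cong: continuous_on_cong)
qed

text \<open>The Laplacian of the composite at \<open>z\<close> is the squared modulus of
  \<open>c\<close> times the Laplacian of \<open>u\<close> at \<open>c * z\<close>: the mixed terms
  from the directions \<open>1\<close> and \<open>\<i>\<close> cancel.\<close>

lemma harmonic_on_compose_mult:
  assumes u: "harmonic_on S u" and "open T" and c: "(*) c ` T \<subseteq> S"
  shows "harmonic_on T (\<lambda>z. u (c * z))"
proof -
  let ?w = "\<lambda>z. u (c * z)"
  define q where "q v = (\<lambda>z. Re (c * v) * dir_deriv 1 u (c * z) + Im (c * v) * dir_deriv \<i> u (c * z))" for v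
  have C1: "C1_on S u" "C1_on S (dir_deriv 1 u)" "C1_on S (dir_deriv \<i> u)"
    using u by (auto simp: harmonic_on_def)
  note w = C1_on_compose_mult[OF C1(1) c] C1_on_compose_mult[OF C1(2) c] C1_on_compose_mult[OF C1(3) c]
  have q: "C1_on T (q v)" for v
    unfolding q_def using w(3,5) by (intro C1_on_linear_combination)
  have eq: "\<forall>z\<in>T. q v z = dir_deriv v ?w z" for v
    using w(2) by (simp add: q_def)
  have dir: "dir_deriv x (dir_deriv v ?w) z = Re (c * v) * dir_deriv x (\<lambda>z. dir_deriv 1 u (c * z)) z
      + Im (c * v) * dir_deriv x (\<lambda>z. dir_deriv \<i> u (c * z)) z" if "z \<in> T" for x v z
    using C1_on_cong(2)[OF \<open>open T\<close> eq q that] C1_on_linear_combination(2)[OF w(3) w(5) that]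
    by (simp add: q_def)
  have lap: "dir_deriv 1 (dir_deriv 1 u) (c * z) + dir_deriv \<i> (dir_deriv \<i> u) (c * z) = 0"
    if "z \<in> T" for z
    using u c that by (auto simp: harmonic_on_def)
  have "dir_deriv 1 (dir_deriv 1 ?w) z + dir_deriv \<i> (dir_deriv \<i> ?w) z = 0" if "z \<in> T" for z
  proof -
    have "dir_deriv 1 (dir_deriv 1 ?w) z + dir_deriv \<i> (dir_deriv \<i> ?w) z =
      ((Re c)\<^sup>2 + (Im c)\<^sup>2) *
        (dir_deriv 1 (dir_deriv 1 u) (c * z) + dir_deriv \<i> (dir_deriv \<i> u) (c * z))"
      by (simp only: dir[OF that] w(4)[OF that] w(6)[OF that]) (simp add: algebra_simps power2_eq_square)
    then show ?thesis using lap[OF that] by simp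
  qed
  then show ?thesis
    using w(1) C1_on_cong(1)[OF \<open>open T\<close> eq q] by (simp add: harmonic_on_def)
qed

lemma harmonic_on_const: "harmonic_on S (\<lambda>_. a)"
proof -
  have "dir_deriv v (\<lambda>_. b) = (\<lambda>_. 0)" for v b
    by (rule ext, rule dir_deriv_eqI) simp
  then show ?thesis
    by (simp add: harmonic_on_def C1_on_def)
qed

text \<open>With u_x and u_y the partial derivatives, u_x - i u_y satisfies the Cauchy-Riemann
  equations, by the symmetry of mixed derivatives and Laplace's equation. On a convex set it has a
  primitive, whose real part is \<open>u\<close> up to a constant.\<close>

lemma harmonic_on_holomorphic_Re:
  assumes S: "open S" "convex S" and u: "harmonic_on S u"
  obtains F where "F holomorphic_on S" "\<And>z. z \<in> S \<Longrightarrow> Re (F z) = u z"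
proof -
  have C1: "C1_on S u" "C1_on S (dir_deriv 1 u)" "C1_on S (dir_deriv \<i> u)"
    using u by (auto simp: harmonic_on_def)
  define g where "g z = complex_of_real (dir_deriv 1 u z) - \<i> * complex_of_real (dir_deriv \<i> u z)" for z
  have "(g has_field_derivative Complex (dir_deriv 1 (dir_deriv 1 u) z) (- dir_deriv 1 (dir_deriv \<i> u) z)) (at z)"
    if z: "z \<in> S" for z
  proof -
    note d1 = has_derivative_dir_deriv[OF C1_on_differentiable[OF C1(2) z]]
    note d2 = has_derivative_dir_deriv[OF C1_on_differentiable[OF C1(3) z]]
    have sym: "dir_deriv \<i> (dir_deriv 1 u) z = dir_deriv 1 (dir_deriv \<i> u) z"
      by (rule second_derivative_symmetric[OF \<open>open S\<close> z has_derivative_dir_deriv[OF C1_on_differentiable[OF C1(1)]] d1 d2])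
    have lap: "dir_deriv \<i> (dir_deriv \<i> u) z = - dir_deriv 1 (dir_deriv 1 u) z"
      using u z by (simp add: harmonic_on_def eq_neg_iff_add_eq_0 add.commute)
    have "(g has_derivative (\<lambda>v. complex_of_real (dir_deriv v (dir_deriv 1 u) z)
         - \<i> * complex_of_real (dir_deriv v (dir_deriv \<i> u) z))) (at z)"
      unfolding g_def
      by (intro has_derivative_diff has_derivative_mult_right has_derivative_of_real d1 d2)
    moreover have "complex_of_real (dir_deriv v (dir_deriv 1 u) z)
         - \<i> * complex_of_real (dir_deriv v (dir_deriv \<i> u) z)
         = Complex (dir_deriv 1 (dir_deriv 1 u) z) (- dir_deriv 1 (dir_deriv \<i> u) z) * v" for v
      by (subst (1) dir_deriv_eq_Re_Im[OF C1_on_differentiable[OF C1(2) z], of v],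
          subst (1) dir_deriv_eq_Re_Im[OF C1_on_differentiable[OF C1(3) z], of v])
        (simp add: complex_eq_iff sym lap algebra_simps)
    ultimately show ?thesis
      by (simp add: has_field_derivative_def)
  qed
  then have "g holomorphic_on S"
    using S by (auto simp: holomorphic_on_open)
  then obtain H where H: "\<And>z. z \<in> S \<Longrightarrow> (H has_field_derivative g z) (at z within S)"
    using holomorphic_convex_primitive' S by blast
  \<comment> \<open>The real part of \<open>g z * h\<close> is u_x Re h + u_y Im h, the differential
    of \<open>u\<close> applied to \<open>h\<close>.\<close>
  have "((\<lambda>z. Re (H z) - u z) has_derivative (\<lambda>h. 0)) (at z within S)" if z: "z \<in> S" for z
  proof -
    have "(H has_derivative (*) (g z)) (at z within S)"
      using H[OF z] unfolding has_field_derivative_def .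
    then have "((\<lambda>z. Re (H z) - u z) has_derivative (\<lambda>h. Re (g z * h) - dir_deriv h u z)) (at z within S)"
      by (rule has_derivative_diff[OF has_derivative_Re has_derivative_at_withinI
          [OF has_derivative_dir_deriv[OF C1_on_differentiable[OF C1(1) z]]]])
    moreover have "Re (g z * h) - dir_deriv h u z = 0" for h
      by (subst dir_deriv_eq_Re_Im[OF C1_on_differentiable[OF C1(1) z]])
        (simp add: g_def)
    ultimately show ?thesis by simp
  qed
  then obtain k where k: "\<And>z. z \<in> S \<Longrightarrow> Re (H z) - u z = k"
    using has_derivative_zero_constant[OF \<open>convex S\<close>, of "\<lambda>z. Re (H z) - u z"] by blast
  show ?thesis
  proof (rule that)
    have "H holomorphic_on S"
      using H S by (auto simp: holomorphic_on_def field_differentiable_def)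
    then show "(\<lambda>z. H z - complex_of_real k) holomorphic_on S"
      by (intro holomorphic_intros)
  qed (use k in fastforce)
qed

text \<open>The estimate is crude: \<open>u\<close> is the real part of a holomorphic \<open>F\<close>, and Cauchy's inequality is
  applied to \<open>exp F\<close>, whose modulus lies between \<open>exp (- B)\<close> and \<open>exp B\<close>.\<close>

lemma harmonic_on_gradient_bound:
  assumes u: "harmonic_on (ball 0 1) u" and B: "\<And>z. z \<in> ball 0 1 \<Longrightarrow> \<bar>u z\<bar> \<le> B"
  shows "\<bar>dir_deriv v u 0\<bar> \<le> 2 * exp (2 * B) * norm v"
proof -
  obtain F where F: "F holomorphic_on ball 0 1" and Re: "\<And>z. z \<in> ball 0 1 \<Longrightarrow> Re (F z) = u z"
    using harmonic_on_holomorphic_Re[OF _ _ u] by auto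
  \<comment> \<open>Only the real part of \<open>F\<close> is bounded; the modulus of the
    exponential does not see the imaginary part.\<close>
  define E where "E z = exp (F z)" for z
  have E: "E holomorphic_on ball 0 1"
    unfolding E_def using F by (intro holomorphic_intros)
  have sub: "ball 0 (1/2) \<subseteq> ball (0::complex) 1" "cball 0 (1/2) \<subseteq> ball (0::complex) 1"
    by auto
  have F': "(F has_field_derivative deriv F 0) (at 0)"
    using F by (rule holomorphic_derivI) auto
  have "(E has_field_derivative exp (F 0) * deriv F 0) (at 0)"
    unfolding E_def by (rule derivative_eq_intros F' refl)+
  then have dE: "deriv E 0 = exp (F 0) * deriv F 0"
    by (rule DERIV_imp_deriv)
  \<comment> \<open>Radius 1/2 keeps the closed disk inside the unit disk and costs the factor 2.
    Dividing by \<open>exp (u 0)\<close>, which is at least \<open>exp (- B)\<close>, then doubles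
    the exponent.\<close>
  have "norm ((deriv ^^ 1) E 0) \<le> fact 1 * exp B / (1/2) ^ 1"
  proof (rule Cauchy_inequality)
    show "norm (E x) \<le> exp B" if "norm (0 - x) = 1 / 2" for x
    proof -
      have "x \<in> ball 0 1" using that by simp
      with B[OF this] Re[OF this] show ?thesis by (simp add: E_def)
    qed
  qed (use E sub in \<open>auto intro: holomorphic_on_subset holomorphic_on_imp_continuous_on continuous_on_subset\<close>)
  then have "exp (u 0) * norm (deriv F 0) \<le> 2 * exp B"
    using Re[of 0] by (simp add: dE norm_mult)
  moreover have "exp (- B) \<le> exp (u 0)"
    using B[of 0] by simp
  ultimately have "exp (- B) * norm (deriv F 0) \<le> 2 * exp B"
    by (meson mult_right_mono norm_ge_zero order_trans)
  then have F'_bound: "norm (deriv F 0) \<le> 2 * exp (2 * B)"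
    using exp_add[of B B] by (simp add: exp_minus field_simps)
  have "((\<lambda>z. Re (F z)) has_derivative (\<lambda>v. Re (deriv F 0 * v))) (at 0)"
    using F' by (intro has_derivative_Re) (simp add: has_field_derivative_def)
  then have "(u has_derivative (\<lambda>v. Re (deriv F 0 * v))) (at 0)"
    by (rule has_derivative_transform_within_open[of _ _ _ _ "ball 0 1"]) (use Re in auto)
  then have "dir_deriv v u 0 = Re (deriv F 0 * v)"
    by (rule dir_deriv_eqI)
  then have "\<bar>dir_deriv v u 0\<bar> \<le> norm (deriv F 0) * norm v"
    using abs_Re_le_cmod[of "deriv F 0 * v"] by (simp add: norm_mult)
  also have "\<dots> \<le> 2 * exp (2 * B) * norm v"
    using F'_bound by (intro mult_right_mono) auto
  finally show ?thesis .
qed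

section \<open>Extremal differentials\<close>

definition admissible :: "nat \<Rightarrow> (nat \<Rightarrow> real) set \<Rightarrow> (nat \<Rightarrow> real) \<Rightarrow> (complex \<Rightarrow> nat \<Rightarrow> real) set" where
  "admissible m G p = {f. harmonic_map_on (ball 0 1) m f \<and> f ` ball 0 1 \<subseteq> G \<and> f 0 = p}"

text \<open>A bound stated vector by vector, without suprema, so that bounds for the factors can be
  squared and added. Any such \<open>C\<close> also guarantees that the suprema in
  \<open>M_dom\<close> are taken over sets bounded above.\<close>

definition differential_bound :: "nat \<Rightarrow> (nat \<Rightarrow> real) set \<Rightarrow> (nat \<Rightarrow> real) \<Rightarrow> real \<Rightarrow> bool" where
  "differential_bound m G p C \<longleftrightarrow>
     (\<forall>f\<in>admissible m G p. \<forall>v. L2_set (differential f 0 v) {..<m} \<le> C * norm v)"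

lemma M_dom_eq_SUP: "M_dom m G p = (SUP f\<in>admissible m G p. op_norm m (differential f 0))"
  unfolding M_dom_def admissible_def by (rule arg_cong[where f = Sup]) auto

lemma differential_eq_dir_deriv: "differential f z v i = dir_deriv v (\<lambda>w. f w i) z"
  by (simp add: differential_def dir_deriv_def)

lemma op_norm_le:
  assumes "\<And>v. L2_set (A v) {..<m} \<le> C * norm v" "0 \<le> C"
  shows "bdd_above (range (\<lambda>v. L2_set (A v) {..<m} / norm v))" and "op_norm m A \<le> C"
proof -
  \<comment> \<open>At \<open>v = 0\<close> the quotient is 0 by the convention for division by
    zero, which is where \<open>0 \<le> C\<close> enters.\<close>
  have le: "L2_set (A v) {..<m} / norm v \<le> C" for v
    using assms by (cases "v = 0") (auto simp: divide_le_eq)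
  then show "bdd_above (range (\<lambda>v. L2_set (A v) {..<m} / norm v))"
    by (intro bdd_aboveI[of _ C]) auto
  show "op_norm m A \<le> C"
    unfolding op_norm_def using le by (intro cSUP_least) auto
qed

lemma le_op_norm:
  assumes "\<And>v. L2_set (A v) {..<m} \<le> C * norm v" "0 \<le> C"
  shows "L2_set (A v) {..<m} \<le> op_norm m A * norm v"
proof (cases "v = 0")
  case False
  have "L2_set (A v) {..<m} / norm v \<le> op_norm m A"
    unfolding op_norm_def using op_norm_le(1)[OF assms] by (intro cSUP_upper) auto
  then show ?thesis
    using False by (simp add: divide_le_eq)
qed (use assms(1)[of 0] in simp)

lemma admissible_const: "p \<in> G \<Longrightarrow> (\<lambda>_. p) \<in> admissible m G p"
  by (auto simp: admissible_def harmonic_map_on_def harmonic_on_const)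

text \<open>Rotation moves the direction \<open>c\<close> to the direction \<open>1\<close>. The
  second claim is limited to \<open>i < m\<close> because \<open>harmonic_map_on\<close> constrains
  just these coordinates.\<close>

lemma admissible_rotate:
  assumes "f \<in> admissible m G p" "norm c = 1"
  shows "(\<lambda>z. f (c * z)) \<in> admissible m G p"
    and "i < m \<Longrightarrow> differential (\<lambda>z. f (c * z)) 0 1 i = differential f 0 c i"
proof -
  have c: "(*) c ` ball 0 1 \<subseteq> ball 0 1"
    using assms(2) by (auto simp: norm_mult)
  then show "(\<lambda>z. f (c * z)) \<in> admissible m G p"
    using assms(1) harmonic_on_compose_mult[OF _ open_ball c]
    by (fastforce simp: admissible_def harmonic_map_on_def)
  show "differential (\<lambda>z. f (c * z)) 0 1 i = differential f 0 c i" if "i < m"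
  proof -
    have C1: "C1_on (ball 0 1) (\<lambda>z. f z i)"
      using assms(1) that by (simp add: admissible_def harmonic_map_on_def harmonic_on_def)
    then have "dir_deriv 1 (\<lambda>z. f (c * z) i) 0 =
        Re c * dir_deriv 1 (\<lambda>z. f z i) 0 + Im c * dir_deriv \<i> (\<lambda>z. f z i) 0"
      using C1_on_compose_mult(2)[OF C1 c, of 0 1] by simp
    also have "\<dots> = dir_deriv c (\<lambda>z. f z i) 0"
      using dir_deriv_eq_Re_Im[OF C1_on_differentiable[OF C1, of 0], of c] by simp
    finally show ?thesis
      by (simp add: differential_eq_dir_deriv)
  qed
qed

context
  fixes m G p C
  assumes p: "p \<in> G" and C: "differential_bound m G p C"
begin

text \<open>The constant map \<open>p\<close> is a competitor, so \<open>C\<close> dominates a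
  norm.\<close>

lemma differential_bound_nonneg: "0 \<le> C"
proof -
  have "0 \<le> L2_set (differential (\<lambda>_. p) 0 1) {..<m}"
    by simp
  also have "\<dots> \<le> C * norm (1 :: complex)"
    using C admissible_const[OF p] unfolding differential_bound_def by blast
  finally show ?thesis by simp
qed

lemma op_norm_differential_le: "f \<in> admissible m G p \<Longrightarrow> op_norm m (differential f 0) \<le> C"
  using C differential_bound_nonneg by (intro op_norm_le(2)) (auto simp: differential_bound_def)

lemma bdd_above_op_norm: "bdd_above ((\<lambda>f. op_norm m (differential f 0)) ` admissible m G p)"
  using op_norm_differential_le by (intro bdd_aboveI[of _ C]) auto

lemma M_dom_least: "M_dom m G p \<le> C"
  unfolding M_dom_eq_SUP using admissible_const[OF p] op_norm_differential_le
  by (intro cSUP_least) auto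

text \<open>Passes from any crude bound \<open>C\<close> to the sharp one; later arguments use
  \<open>M_dom\<close> through this form.\<close>

lemma differential_bound_M_dom: "differential_bound m G p (M_dom m G p)"
  unfolding differential_bound_def
proof (intro ballI allI)
  fix f v assume f: "f \<in> admissible m G p"
  have "L2_set (differential f 0 v) {..<m} \<le> op_norm m (differential f 0) * norm v"
    using C f differential_bound_nonneg by (intro le_op_norm) (auto simp: differential_bound_def)
  also have "\<dots> \<le> M_dom m G p * norm v"
    unfolding M_dom_eq_SUP using bdd_above_op_norm f by (intro mult_right_mono cSUP_upper) auto
  finally show "L2_set (differential f 0 v) {..<m} \<le> M_dom m G p * norm v" .
qed

text \<open>First a map, then a direction is chosen close to the supremum, and a rotation moves that
  direction to \<open>1\<close>. The loss is a factor \<open>t\<close>, which passes unchanged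
  through a sum over the factors.\<close>

lemma M_dom_nearly_attained:
  assumes t: "0 < t" "t < 1"
  obtains f where "f \<in> admissible m G p" "t * M_dom m G p \<le> L2_set (differential f 0 1) {..<m}"
\<comment> \<open>In this case \<open>t * M_dom m G p\<close> need not lie strictly below the
  supremum, but the constant map suffices.\<close>
proof (cases "M_dom m G p \<le> 0")
  case True
  then have "t * M_dom m G p \<le> L2_set (differential (\<lambda>_. p) 0 1) {..<m}"
    using t by (meson L2_set_nonneg mult_nonneg_nonpos less_imp_le order_trans)
  then show ?thesis
    using that admissible_const[OF p] by blast
next
  case False
  then have "t * M_dom m G p < M_dom m G p"
    using t by simp
  then obtain f where f: "f \<in> admissible m G p" and "t * M_dom m G p < op_norm m (differential f 0)"
    using admissible_const[OF p] bdd_above_op_norm less_cSUP_iff[of "admissible m G p"]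
    unfolding M_dom_eq_SUP by blast
  moreover have "bdd_above (range (\<lambda>v. L2_set (differential f 0 v) {..<m} / norm v))"
    using C f differential_bound_nonneg by (intro op_norm_le(1)) (auto simp: differential_bound_def)
  ultimately obtain v where v: "t * M_dom m G p < L2_set (differential f 0 v) {..<m} / norm v"
    unfolding op_norm_def by (subst (asm) less_cSUP_iff) auto
  \<comment> \<open>For \<open>v = 0\<close> the quotient would be 0, whereas
    \<open>t * M_dom m G p\<close> is positive here.\<close>
  have "v \<noteq> 0"
    using v t False by (auto simp: mult_less_0_iff)
  define c where "c = v / norm v"
  have c: "norm c = 1"
    using \<open>v \<noteq> 0\<close> by (simp add: c_def norm_divide)
  have dc: "differential f 0 c i = differential f 0 v i / norm v" if "i < m" for i
  proof -
    have "(\<lambda>z. f z i) differentiable (at 0)"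
      using f that by (intro C1_on_differentiable[of "ball 0 1"])
        (auto simp: admissible_def harmonic_map_on_def harmonic_on_def)
    from dir_deriv_eq_Re_Im[OF this, of c] dir_deriv_eq_Re_Im[OF this, of v] show ?thesis
      by (simp add: differential_eq_dir_deriv c_def add_divide_distrib)
  qed
  have "L2_set (differential (\<lambda>z. f (c * z)) 0 1) {..<m} =
      L2_set (\<lambda>i. differential f 0 v i / norm v) {..<m}"
    using admissible_rotate(2)[OF f c] dc by (intro L2_set_cong) auto
  also have "\<dots> = L2_set (differential f 0 v) {..<m} / norm v"
    using L2_set_left_distrib[of "1 / norm v" "differential f 0 v" "{..<m}"] by simp
  finally show ?thesis
    using that[OF admissible_rotate(1)[OF f c]] v by simp
qed

end

lemma bounded_domain_coord_zero:
  assumes "bounded_domain m G" "x \<in> G" "m \<le> i"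
  shows "x i = 0"
proof -
  have "G \<subseteq> topspace (Euclidean_space m)"
    using assms(1) openin_subset by (auto simp: bounded_domain_def)
  then show ?thesis
    using assms by (auto simp: topspace_Euclidean_space)
qed

text \<open>Each coordinate of a competitor is a harmonic function bounded by \<open>B\<close>, so
  the gradient bound applies. Estimating the Euclidean norm by the sum of the absolute values gives
  the factor \<open>m\<close>.\<close>

lemma bounded_domain_differential_bound:
  assumes "bounded_domain m G"
  obtains C where "differential_bound m G p C"
proof -
  obtain B where B: "\<And>x. x \<in> G \<Longrightarrow> L2_set x {..<m} \<le> B"
    using assms by (auto simp: bounded_domain_def)
  have "L2_set (differential f 0 v) {..<m} \<le> real m * (2 * exp (2 * B)) * norm v"
    if f: "f \<in> admissible m G p" for f v
  proof -
    have coord: "\<bar>x i\<bar> \<le> B" if "x \<in> G" "i < m" for x i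
      using B[OF that(1)] member_le_L2_set[of "{..<m}" i "\<lambda>i. \<bar>x i\<bar>"] that by (simp add: L2_set_def)
    have "\<bar>differential f 0 v i\<bar> \<le> 2 * exp (2 * B) * norm v" if "i < m" for i
      unfolding differential_eq_dir_deriv
    proof (rule harmonic_on_gradient_bound)
      show "harmonic_on (ball 0 1) (\<lambda>z. f z i)"
        using f that by (simp add: admissible_def harmonic_map_on_def)
      show "\<bar>f z i\<bar> \<le> B" if "z \<in> ball 0 1" for z
        using f that by (intro coord[OF _ \<open>i < m\<close>]) (auto simp: admissible_def)
    qed
    then have "(\<Sum>i<m. \<bar>differential f 0 v i\<bar>) \<le> (\<Sum>i<m. 2 * exp (2 * B) * norm v)"
      by (intro sum_mono) auto
    then show ?thesis
      using L2_set_le_sum_abs[of "differential f 0 v" "{..<m}"] by simp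
  qed
  then show ?thesis
    using that unfolding differential_bound_def by blast
qed

section \<open>Products\<close>

lemma sum_lessThan_add:
  fixes h :: "nat \<Rightarrow> 'a::comm_monoid_add"
  shows "(\<Sum>i<a + b. h i) = (\<Sum>i<a. h i) + (\<Sum>k<b. h (a + k))"
  by (induction b) (auto simp: add.assoc)

text \<open>The position just after the last block is the total dimension, so
  \<open>offset_mono\<close> with \<open>Suc N\<close> bounds every block.\<close>

lemma offset_Suc: "offset m (Suc N) = (\<Sum>j=1..N. m j)"
  by (simp add: offset_def atLeastLessThanSuc_atLeastAtMost)

lemma sum_blocks:
  fixes h :: "nat \<Rightarrow> 'a::comm_monoid_add"
  shows "(\<Sum>i<(\<Sum>j=1..N. m j). h i) = (\<Sum>j=1..N. \<Sum>k<m j. h (offset m j + k))"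
  by (induction N) (simp_all add: sum_lessThan_add offset_Suc)

lemma block_index_less:
  assumes "j \<in> {1..N}" "k < m j"
  shows "offset m j + k < (\<Sum>j=1..N. m j)"
  using offset_mono[of j "Suc N" m] assms by (auto simp: offset_Suc)

lemma block_index_exists:
  assumes "i < (\<Sum>j=1..N. m j)"
  obtains j k where "j \<in> {1..N}" "k < m j" "i = offset m j + k"
proof -
  have "\<exists>j\<in>{1..N}. \<exists>k<m j. i = offset m j + k"
    using assms
  proof (induction N)
    case (Suc N)
    show ?case
    proof (cases "i < (\<Sum>j=1..N. m j)")
      case True
      then show ?thesis using Suc.IH by fastforce
    next
      case False
      then have "i = offset m (Suc N) + (i - offset m (Suc N)) \<and> i - offset m (Suc N) < m (Suc N)"
        using Suc.prems by (auto simp: offset_Suc)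
      then show ?thesis by fastforce
    qed
  qed simp
  then show ?thesis using that by blast
qed

text \<open>Pythagoras for the orthogonal decomposition into blocks; the source of the squares in
  the theorem.\<close>

lemma L2_set_blocks:
  "(L2_set h {..<(\<Sum>j=1..N. m j)})\<^sup>2 = (\<Sum>j=1..N. (L2_set (\<lambda>k. h (offset m j + k)) {..<m j})\<^sup>2)"
  using sum_blocks[of "\<lambda>i. (h i)\<^sup>2" m N] by (simp add: L2_set_def sum_nonneg)

text \<open>Points of \<open>G j\<close> are sequences vanishing from position \<open>m j\<close>
  on, so a block has to be cut out and padded with zeros to be such a point.\<close>

lemma admissible_block:
  assumes f: "f \<in> admissible (\<Sum>j=1..N. m j) (prod_dom N m G) (concat_vec N m p)"
    and j: "j \<in> {1..N}" and G: "bounded_domain (m j) (G j)" and p: "p j \<in> G j"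
  shows "(\<lambda>z k. if k < m j then f z (offset m j + k) else 0) \<in> admissible (m j) (G j) (p j)"
proof -
  have block: "(\<lambda>k. if k < m j then concat_vec N m x (offset m j + k) else 0) = x j" if "x j \<in> G j" for x
    using bounded_domain_coord_zero[OF G that] by (auto simp: concat_vec_block[OF j] not_less)
  have "harmonic_on (ball 0 1) (\<lambda>z. if k < m j then f z (offset m j + k) else 0)" if "k < m j" for k
    using f that block_index_less[of j N k m, OF j that] by (simp add: admissible_def harmonic_map_on_def)
  moreover have "(\<lambda>k. if k < m j then f z (offset m j + k) else 0) \<in> G j" if "z \<in> ball 0 1" for z
  proof -
    have "f z \<in> prod_dom N m G"
      using f that by (auto simp: admissible_def)
    then obtain x where x: "f z = concat_vec N m x" "x j \<in> G j"
      using j by (auto simp: prod_dom_def)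
    then show ?thesis unfolding x(1) block[of x, OF x(2)] by blast
  qed
  moreover have "(\<lambda>k. if k < m j then f 0 (offset m j + k) else 0) = p j"
  proof -
    have "f 0 = concat_vec N m p"
      using f by (simp add: admissible_def)
    then show ?thesis using block[of p, OF p] by metis
  qed
  ultimately show ?thesis
    by (simp add: admissible_def harmonic_map_on_def image_subset_iff)
qed

text \<open>Each position below the total dimension lies in some block, where the coordinate
  function is a harmonic coordinate of one \<open>g j\<close>.\<close>

lemma admissible_concat:
  assumes "\<And>j. j \<in> {1..N} \<Longrightarrow> g j \<in> admissible (m j) (G j) (p j)"
  shows "(\<lambda>z. concat_vec N m (\<lambda>j. g j z)) \<in> admissible (\<Sum>j=1..N. m j) (prod_dom N m G) (concat_vec N m p)"
proof -
  have "harmonic_on (ball 0 1) (\<lambda>z. concat_vec N m (\<lambda>j. g j z) i)" if "i < (\<Sum>j=1..N. m j)" for i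
    using that
  proof (rule block_index_exists)
    fix j k assume "j \<in> {1..N}" "k < m j" "i = offset m j + k"
    then show ?thesis
      using assms by (auto simp: concat_vec_block admissible_def harmonic_map_on_def)
  qed
  moreover have "concat_vec N m (\<lambda>j. g j z) \<in> prod_dom N m G" if "z \<in> ball 0 1" for z
    using assms that by (force simp: prod_dom_def admissible_def)
  moreover have "concat_vec N m (\<lambda>j. g j 0) = concat_vec N m p"
    unfolding concat_vec_def using assms by (intro ext sum.cong) (auto simp: admissible_def)
  ultimately show ?thesis
    by (auto simp: admissible_def harmonic_map_on_def)
qed

theorem theorem7p1:
  fixes N :: nat and m :: "nat \<Rightarrow> nat"
    and G :: "nat \<Rightarrow> (nat \<Rightarrow> real) set" and p :: "nat \<Rightarrow> nat \<Rightarrow> real"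
  assumes "N \<ge> 1"
    and "\<And>j. j \<in> {1..N} \<Longrightarrow> bounded_domain (m j) (G j)"
    and "\<And>j. j \<in> {1..N} \<Longrightarrow> p j \<in> G j"
  shows "(M_dom (\<Sum>j=1..N. m j) (prod_dom N m G) (concat_vec N m p))\<^sup>2
       = (\<Sum>j=1..N. (M_dom (m j) (G j) (p j))\<^sup>2)"
proof -
  define n where "n = (\<Sum>j=1..N. m j)"
  define H where "H = prod_dom N m G"
  define q where "q = concat_vec N m p"
  define M where "M j = M_dom (m j) (G j) (p j)" for j
  have "q \<in> H"
    using assms(3) by (auto simp: q_def H_def prod_dom_def)
  have M: "differential_bound (m j) (G j) (p j) (M j)" if "j \<in> {1..N}" for j
    unfolding M_def using assms that
    by (meson bounded_domain_differential_bound differential_bound_M_dom)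
  \<comment> \<open>This gives the upper inequality and also the finiteness of
    \<open>M_dom n H q\<close>, on which \<open>Mq\<close> rests.\<close>
  have bound: "differential_bound n H q (sqrt (\<Sum>j=1..N. (M j)\<^sup>2))"
    unfolding differential_bound_def
  proof (intro ballI allI)
    fix f v assume f: "f \<in> admissible n H q"
    have "(L2_set (differential f 0 v) {..<n})\<^sup>2 =
        (\<Sum>j=1..N. (L2_set (\<lambda>k. differential f 0 v (offset m j + k)) {..<m j})\<^sup>2)"
      unfolding n_def by (rule L2_set_blocks)
    also have "\<dots> \<le> (\<Sum>j=1..N. (M j * norm v)\<^sup>2)"
    proof (intro sum_mono power_mono)
      fix j assume j: "j \<in> {1..N}"
      let ?g = "\<lambda>z k. if k < m j then f z (offset m j + k) else 0"
      have "?g \<in> admissible (m j) (G j) (p j)"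
        using f j assms unfolding n_def H_def q_def by (intro admissible_block)
      then have "L2_set (differential ?g 0 v) {..<m j} \<le> M j * norm v"
        using M[OF j] by (auto simp: differential_bound_def)
      also have "L2_set (differential ?g 0 v) {..<m j} =
          L2_set (\<lambda>k. differential f 0 v (offset m j + k)) {..<m j}"
        by (intro L2_set_cong) (auto simp: differential_def)
      finally show "L2_set (\<lambda>k. differential f 0 v (offset m j + k)) {..<m j} \<le> M j * norm v" .
    qed simp
    also have "\<dots> = (\<Sum>j=1..N. (M j)\<^sup>2) * (norm v)\<^sup>2"
      by (simp add: power_mult_distrib sum_distrib_right)
    also have "\<dots> = (sqrt (\<Sum>j=1..N. (M j)\<^sup>2) * norm v)\<^sup>2"
      by (simp add: power_mult_distrib sum_nonneg)
    finally show "L2_set (differential f 0 v) {..<n} \<le> sqrt (\<Sum>j=1..N. (M j)\<^sup>2) * norm v"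
      by (rule power2_le_imp_le) (simp add: sum_nonneg)
  qed
  have Mq: "differential_bound n H q (M_dom n H q)"
    using \<open>q \<in> H\<close> bound by (rule differential_bound_M_dom)
  have "M_dom n H q \<le> sqrt (\<Sum>j=1..N. (M j)\<^sup>2)"
    using \<open>q \<in> H\<close> bound by (rule M_dom_least)
  \<comment> \<open>Squaring requires \<open>M_dom n H q\<close> to be nonnegative, which follows
    from its being a differential bound itself.\<close>
  then have "(M_dom n H q)\<^sup>2 \<le> (sqrt (\<Sum>j=1..N. (M j)\<^sup>2))\<^sup>2"
    using differential_bound_nonneg[OF \<open>q \<in> H\<close> Mq] by (rule power_mono)
  then have le: "(M_dom n H q)\<^sup>2 \<le> (\<Sum>j=1..N. (M j)\<^sup>2)"
    by (simp add: sum_nonneg)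
  \<comment> \<open>The suprema for the factors may not be attained, so the lower inequality is
    first proved with a loss of \<open>t\<^sup>2\<close>.\<close>
  have scaled: "t\<^sup>2 * (\<Sum>j=1..N. (M j)\<^sup>2) \<le> (M_dom n H q)\<^sup>2" if t: "0 < t" "t < 1" for t
  proof -
    have "\<exists>g. g \<in> admissible (m j) (G j) (p j) \<and> t * M j \<le> L2_set (differential g 0 1) {..<m j}"
      if j: "j \<in> {1..N}" for j
      using M_dom_nearly_attained[OF assms(3)[OF j] M[OF j] t] unfolding M_def by blast
    then obtain g where g: "\<And>j. j \<in> {1..N} \<Longrightarrow> g j \<in> admissible (m j) (G j) (p j)"
      and gt: "\<And>j. j \<in> {1..N} \<Longrightarrow> t * M j \<le> L2_set (differential (g j) 0 1) {..<m j}"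
      by metis
    \<comment> \<open>All \<open>g j\<close> are nearly extremal in the common direction
      \<open>1\<close>, so evaluating the differential of the tuple there collects all the factors
      at once.\<close>
    define f where "f z = concat_vec N m (\<lambda>j. g j z)" for z
    have f: "f \<in> admissible n H q"
      unfolding f_def n_def H_def q_def using g by (rule admissible_concat)
    have "t\<^sup>2 * (\<Sum>j=1..N. (M j)\<^sup>2) = (\<Sum>j=1..N. (t * M j)\<^sup>2)"
      by (simp add: power_mult_distrib sum_distrib_left)
    also have "\<dots> \<le> (\<Sum>j=1..N. (L2_set (differential (g j) 0 1) {..<m j})\<^sup>2)"
      using gt t differential_bound_nonneg[OF assms(3) M] by (intro sum_mono power_mono) auto
    also have "\<dots> = (\<Sum>j=1..N. (L2_set (\<lambda>k. differential f 0 1 (offset m j + k)) {..<m j})\<^sup>2)"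
      by (intro sum.cong arg_cong[where f = "\<lambda>x. x\<^sup>2"] L2_set_cong)
        (auto simp: differential_def f_def concat_vec_block)
    also have "\<dots> = (L2_set (differential f 0 1) {..<n})\<^sup>2"
      unfolding n_def by (rule L2_set_blocks[symmetric])
    also have "\<dots> \<le> (M_dom n H q)\<^sup>2"
    proof (rule power_mono)
      show "L2_set (differential f 0 1) {..<n} \<le> M_dom n H q"
        using Mq f unfolding differential_bound_def by (metis mult.right_neutral norm_one)
    qed simp
    finally show ?thesis .
  qed
  have "(\<Sum>j=1..N. (M j)\<^sup>2) \<le> (M_dom n H q)\<^sup>2"
  \<comment> \<open>The loss is removed by letting \<open>s = t\<^sup>2\<close> range over all of
    (0, 1).\<close>
  proof (rule field_le_mult_one_interval)
    fix s :: real assume "0 < s" "s < 1"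
    then show "s * (\<Sum>j=1..N. (M j)\<^sup>2) \<le> (M_dom n H q)\<^sup>2"
      using scaled[of "sqrt s"] by simp
  qed
  with le show ?thesis
    by (simp add: n_def H_def q_def M_def)
qed

end
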